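(* Let $G$ be a connected graph. Then $G$ is a $2$-$\chi_{ig}^{A}$-game-vertex-critical graph if and only if $G=K_2$. Likewise, $G$ is a $2$-$\chi_{ig}^{AB}$-game-vertex-critical graph if and only if $G=K_2$.
   Context: All graphs are simple, undirected and finite. The independence coloring game on a graph $G$ is played by Alice and Bob in rounds, round $i$ being played with color $i$ ($i=1,2,\ldots$). Within a round the players alternate moves, each move consisting of coloring a previously uncolored vertex with the color of the round so that the vertices colored in the same round form an independent set. A round is completed when no uncolored vertex can be given the color of the round (every uncolored vertex is adjacent to a vertex colored in this round). The game is over when all vertices are colored. Alice wants to finish in as few rounds as possible, Bob in as many rounds as possible. In the A-independence coloring game every round is started by Alice; the number of rounds when both players play optimally is the A-independence game chromatic number $\chi_{ig}^{A}(G)$. In the AB-independence coloring game Alice starts the first round and each further round is started by the player who did not make the last move of the previous round; the number of rounds when both players play optimally is the AB-independence game chromatic number $\chi_{ig}^{AB}(G)$. For $x\in V(G)$, $G-x$ is the graph obtained from $G$ by deleting $x$ and all edges incident with $x$. For $\varphi\in\{\chi_{ig}^{A},\chi_{ig}^{AB}\}$, a graph $G$ is $k$-$\varphi$-game-vertex-critical if $\varphi(G)=k$ and $\varphi(G-x)\neq\varphi(G)$ for every $x\in V(G)$. $K_n$ is the complete graph of order $n$; equality of graphs means isomorphism. *)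

theory Defs
  imports "Graph_Theory.Graph_Theory"
begin

text \<open>
  Simple, undirected, finite graphs are the symmetric, loop-free digraphs without parallel
  arcs given by the locale \<^locale>\<open>graph\<close>; two vertices are adjacent iff they
  are joined by an arc, i.e. \<open>u \<rightarrow>\<^bsub>G\<^esub> v\<close>.
\<close>

datatype player = Alice | Bob

primrec opponent :: "player \<Rightarrow> player" where
  "opponent Alice = Bob"
| "opponent Bob = Alice"

datatype variant = A_variant | AB_variant

text \<open>
  Who starts the next round, if \<open>p\<close> made the last move of the round just completed.
\<close>
primrec next_starter :: "variant \<Rightarrow> player \<Rightarrow> player" where
  "next_starter A_variant p = Alice"
| "next_starter AB_variant p = opponent p"

text \<open>
  A position consists of the player \<open>p\<close> to move, the set \<open>U\<close> of
  uncolored vertices, and the set \<open>C\<close> of vertices colored so far in the current round.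
  The vertices that may receive the color of the current round are the following.
\<close>
definition playable :: "('a,'b) pre_digraph \<Rightarrow> 'a set \<Rightarrow> 'a set \<Rightarrow> 'a set" where
  "playable G U C = {v \<in> U. \<forall>u \<in> C. \<not> u \<rightarrow>\<^bsub>G\<^esub> v}"

text \<open>
  Minimax value of a position: the number of rounds that are still to be started, if Alice
  minimizes and Bob maximizes this number. A round is counted when its first vertex is colored
  (\<open>C = {}\<close>). In the second branch the current round is completed; its last move was
  made by the opponent of the player \<open>p\<close> who would be next. The value for infinite
  \<open>U\<close> is a dummy that makes the recursion terminate.
\<close>
function rounds_to_go ::
  "variant \<Rightarrow> ('a,'b) pre_digraph \<Rightarrow> player \<Rightarrow> 'a set \<Rightarrow> 'a set \<Rightarrow> nat" where
  "rounds_to_go var G p U C =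
    (if U = {} \<or> infinite U then 0
     else if playable G U C = {} then rounds_to_go var G (next_starter var (opponent p)) U {}
     else (if C = {} then 1 else 0) +
       (case p of
          Alice \<Rightarrow>
            Min ((\<lambda>v. rounds_to_go var G Bob (U - {v}) (insert v C)) ` playable G U C)
        | Bob \<Rightarrow>
            Max ((\<lambda>v. rounds_to_go var G Alice (U - {v}) (insert v C)) ` playable G U C)))"
  by pat_completeness auto
termination
  by (relation "measures [\<lambda>(var, G, p, U, C). card U, \<lambda>(var, G, p, U, C). if C = {} then 0 else 1]")
     (auto simp: playable_def card_gt_0_iff)

declare rounds_to_go.simps [simp del]

definition chi_ig_A :: "('a,'b) pre_digraph \<Rightarrow> nat" where
  "chi_ig_A G = rounds_to_go A_variant G Alice (verts G) {}"

definition chi_ig_AB :: "('a,'b) pre_digraph \<Rightarrow> nat" where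
  "chi_ig_AB G = rounds_to_go AB_variant G Alice (verts G) {}"

definition game_vertex_critical ::
  "nat \<Rightarrow> (('a,'b) pre_digraph \<Rightarrow> nat) \<Rightarrow> ('a,'b) pre_digraph \<Rightarrow> bool" where
  "game_vertex_critical k \<phi> G \<longleftrightarrow>
    \<phi> G = k \<and> (\<forall>x \<in> verts G. \<phi> (pre_digraph.del_vert G x) \<noteq> \<phi> G)"

end

theory Submission
  imports Defs
begin

text \<open>
  If the game lasts two rounds, then the color classes give a bipartition of \<open>G\<close>, which is unique
  because \<open>G\<close> is connected. Let \<open>a\<close> be an optimal first move of Alice. If some vertex of the other
  side were not adjacent to \<open>a\<close>, then Bob could color it in the first round, and no play would
  produce the bipartition. So \<open>a\<close> is adjacent to the whole other side. Conversely, such a dominating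
  vertex lets Alice finish in two rounds, since the first color can then be used on the side
  of \<open>a\<close> only. Its existence survives the deletion of any vertex other than \<open>a\<close>, as long as the
  other side does not become empty; so a critical \<open>G\<close> has only one further vertex.
\<close>

section \<open>Unfolding the game recursion and optimal moves\<close>

definition indep_verts :: "('a,'b) pre_digraph \<Rightarrow> 'a set \<Rightarrow> bool" where
  "indep_verts G S \<longleftrightarrow> (\<forall>u\<in>S. \<forall>v\<in>S. \<not> u \<rightarrow>\<^bsub>G\<^esub> v)"

lemma indep_verts_subset: "indep_verts G S \<Longrightarrow> T \<subseteq> S \<Longrightarrow> indep_verts G T"
  by (auto simp: indep_verts_def)

lemma finite_playable: "finite U \<Longrightarrow> finite (playable G U C)"
  by (simp add: playable_def)

lemma rounds_to_go_completed:
  "finite U \<Longrightarrow> U \<noteq> {} \<Longrightarrow> playable G U C = {} \<Longrightarrow>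
    rounds_to_go var G p U C = rounds_to_go var G (next_starter var (opponent p)) U {}"
  by (subst rounds_to_go.simps) simp

lemma rounds_to_go_Alice:
  "finite U \<Longrightarrow> playable G U C \<noteq> {} \<Longrightarrow>
    rounds_to_go var G Alice U C = (if C = {} then 1 else 0) +
      Min ((\<lambda>v. rounds_to_go var G Bob (U - {v}) (insert v C)) ` playable G U C)"
  by (subst rounds_to_go.simps) (auto simp: playable_def)

lemma rounds_to_go_Bob:
  "finite U \<Longrightarrow> playable G U C \<noteq> {} \<Longrightarrow>
    rounds_to_go var G Bob U C = (if C = {} then 1 else 0) +
      Max ((\<lambda>v. rounds_to_go var G Alice (U - {v}) (insert v C)) ` playable G U C)"
  by (subst rounds_to_go.simps) (auto simp: playable_def)

text \<open>\<open>Min\<close> and \<open>Max\<close> over a finite nonempty set are attained, so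
  either player has an optimal move. Inductions can thus follow optimal play without a case split on
  \<open>p\<close>.\<close>

lemma rounds_to_go_move:
  assumes "finite U" "playable G U C \<noteq> {}"
  obtains v where "v \<in> playable G U C"
    "rounds_to_go var G p U C = (if C = {} then 1 else 0) +
       rounds_to_go var G (opponent p) (U - {v}) (insert v C)"
proof (cases p)
  case Alice
  have "Min ((\<lambda>v. rounds_to_go var G Bob (U - {v}) (insert v C)) ` playable G U C)
      \<in> (\<lambda>v. rounds_to_go var G Bob (U - {v}) (insert v C)) ` playable G U C"
    using assms by (intro Min_in) (auto simp: finite_playable)
  with Alice that show ?thesis by (auto simp: rounds_to_go_Alice[OF assms])
next
  case Bob
  have "Max ((\<lambda>v. rounds_to_go var G Alice (U - {v}) (insert v C)) ` playable G U C)
      \<in> (\<lambda>v. rounds_to_go var G Alice (U - {v}) (insert v C)) ` playable G U C"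
    using assms by (intro Max_in) (auto simp: finite_playable)
  with Bob that show ?thesis by (auto simp: rounds_to_go_Bob[OF assms])
qed

text \<open>Every uncolored vertex stays playable, so one round absorbs all of \<open>U\<close>; it
  is counted here only if it has not been started yet.\<close>

lemma rounds_to_go_independent:
  assumes "finite U" "U \<noteq> {}" "indep_verts G U" "\<And>u v. u \<in> C \<Longrightarrow> v \<in> U \<Longrightarrow> \<not> u \<rightarrow>\<^bsub>G\<^esub> v"
  shows "rounds_to_go var G p U C = (if C = {} then 1 else 0)"
  using assms
proof (induction "card U" arbitrary: U C p)
  case 0
  then show ?case by simp
next
  case (Suc n)
  have "playable G U C = U"
    using Suc.prems by (auto simp: playable_def)
  then obtain v where v: "v \<in> U" "rounds_to_go var G p U C = (if C = {} then 1 else 0) +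
      rounds_to_go var G (opponent p) (U - {v}) (insert v C)"
    using Suc.prems(1,2) by (metis rounds_to_go_move)
  have "rounds_to_go var G (opponent p) (U - {v}) (insert v C) = 0"
  proof (cases "U - {v} = {}")
    case True
    show ?thesis unfolding True by (subst rounds_to_go.simps) simp
  next
    case False
    have card: "n = card (U - {v})"
      using Suc.hyps(2) Suc.prems(1) v(1) by simp
    have "indep_verts G (U - {v})"
      using Suc.prems(3) by (auto intro: indep_verts_subset)
    moreover have "\<not> u \<rightarrow>\<^bsub>G\<^esub> w" if "u \<in> insert v C" "w \<in> U - {v}" for u w
      using Suc.prems(3,4) v(1) that by (auto simp: indep_verts_def)
    ultimately show ?thesis
      using Suc.hyps(1)[OF card _ False, of "insert v C" "opponent p"] Suc.prems(1) by simp
  qed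
  with v(2) show ?case by simp
qed

lemma rounds_to_go_Bob_ge:
  assumes "finite U" "v \<in> playable G U C"
  shows "rounds_to_go var G Alice (U - {v}) (insert v C) \<le> rounds_to_go var G Bob U C"
proof -
  have "rounds_to_go var G Alice (U - {v}) (insert v C)
      \<le> Max ((\<lambda>v. rounds_to_go var G Alice (U - {v}) (insert v C)) ` playable G U C)"
    using assms by (intro Max_ge) (auto simp: finite_playable)
  moreover have "playable G U C \<noteq> {}" using assms(2) by blast
  ultimately show ?thesis
    using assms(1) by (simp add: rounds_to_go_Bob)
qed

lemma rounds_to_go_Alice_first_le:
  assumes "finite U" "v \<in> U"
  shows "rounds_to_go var G Alice U {} \<le> 1 + rounds_to_go var G Bob (U - {v}) {v}"
proof -
  have pl: "playable G U {} = U" by (simp add: playable_def)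
  have "Min ((\<lambda>v. rounds_to_go var G Bob (U - {v}) {v}) ` U) \<le> rounds_to_go var G Bob (U - {v}) {v}"
    using assms by (intro Min_le) auto
  moreover have "U \<noteq> {}" using assms(2) by blast
  ultimately show ?thesis
    using assms(1) rounds_to_go_Alice[of U G "{}" var] by (simp add: pl)
qed

lemma rounds_to_go_new_round:
  assumes "finite U" "U \<noteq> {}"
  obtains v where "v \<in> U"
    "rounds_to_go var G p U {} = 1 + rounds_to_go var G (opponent p) (U - {v}) {v}"
proof -
  have "playable G U {} = U" by (simp add: playable_def)
  with rounds_to_go_move[OF assms(1), of G "{}" var p] assms(2) that show ?thesis by auto
qed

text \<open>\<open>Y\<close> is blocked by \<open>C\<close> for the rest of the round, while
  vertices of \<open>X\<close> never become blocked. So this round colors exactly \<open>X\<close>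
  and the next one exactly \<open>Y\<close>, whatever the players do. Since \<open>C\<close> is
  nonempty, only the round for \<open>Y\<close> is still to be counted.\<close>

lemma rounds_to_go_dominated_side:
  assumes "finite X" "finite Y" "Y \<noteq> {}" "indep_verts G Y" "indep_verts G (C \<union> X)"
    "X \<inter> Y = {}" "C \<noteq> {}" "\<And>y. y \<in> Y \<Longrightarrow> \<exists>c\<in>C. c \<rightarrow>\<^bsub>G\<^esub> y"
  shows "rounds_to_go var G p (X \<union> Y) C = 1"
  using assms
proof (induction X arbitrary: C p rule: finite_psubset_induct)
  case (psubset X)
  have pl: "playable G (X \<union> Y) C = X"
  proof
    show "playable G (X \<union> Y) C \<subseteq> X"
      using psubset.prems(7) by (auto simp: playable_def)
    show "X \<subseteq> playable G (X \<union> Y) C"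
      using psubset.prems(4) by (simp add: playable_def indep_verts_def subset_iff)
  qed
  show ?case
  proof (cases "X = {}")
    case True
    \<comment> \<open>Who starts this round depends on \<open>var\<close> and \<open>p\<close>,
      hence the claim for every \<open>q\<close>.\<close>
    have "rounds_to_go var G q Y {} = 1" for q
      using rounds_to_go_independent[of Y G "{}" var q] psubset.prems(1-3) by simp
    with True psubset.prems(1,2) pl show ?thesis
      by (simp add: rounds_to_go_completed)
  next
    case False
    then obtain v where v: "v \<in> X" "rounds_to_go var G p (X \<union> Y) C =
        rounds_to_go var G (opponent p) (X \<union> Y - {v}) (insert v C)"
      using rounds_to_go_move[of "X \<union> Y" G C var p] pl psubset.hyps psubset.prems(1,6) by auto
    have "X \<union> Y - {v} = (X - {v}) \<union> Y" "insert v C \<union> (X - {v}) = C \<union> X"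
      using v(1) psubset.prems(5) by auto
    then show ?thesis
      using v psubset.IH[of "X - {v}" "insert v C" "opponent p"] psubset.prems by auto
  qed
qed

section \<open>Independent sets extracted from short games\<close>

locale game_graph =
  fixes G :: "('a,'b) pre_digraph"
  assumes adj_sym: "u \<rightarrow>\<^bsub>G\<^esub> v \<Longrightarrow> v \<rightarrow>\<^bsub>G\<^esub> u"
    and adj_irrefl: "\<not> u \<rightarrow>\<^bsub>G\<^esub> u"
begin

lemma independent_insert_playable:
  "indep_verts G C \<Longrightarrow> v \<in> playable G U C \<Longrightarrow> indep_verts G (insert v C)"
  using adj_sym adj_irrefl by (auto simp: indep_verts_def playable_def)

text \<open>Value 0 means that no further round starts, so optimal play adds all of \<open>U\<close>
  to the current color class \<open>C\<close>.\<close>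

lemma rounds_to_go_eq_0_imp_independent:
  assumes "finite U" "indep_verts G C" "rounds_to_go var G p U C = 0"
  shows "indep_verts G (C \<union> U)"
  using assms
proof (induction U arbitrary: C p rule: finite_psubset_induct)
  case (psubset U)
  consider "U = {}" | "U \<noteq> {}" "playable G U C = {}" | "playable G U C \<noteq> {}"
    by blast
  then show ?case
  proof cases
    case 1
    then show ?thesis using psubset.prems by simp
  next
    case 2
    have "rounds_to_go var G (next_starter var (opponent p)) U {} = 0"
      using rounds_to_go_completed[OF psubset.hyps 2, of var p] psubset.prems(2) by simp
    moreover obtain v where "rounds_to_go var G (next_starter var (opponent p)) U {} =
        1 + rounds_to_go var G (opponent (next_starter var (opponent p))) (U - {v}) {v}"
      by (rule rounds_to_go_new_round[OF psubset.hyps 2(1)])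
    ultimately show ?thesis by simp
  next
    case 3
    obtain v where v: "v \<in> playable G U C"
      and step: "rounds_to_go var G p U C = (if C = {} then 1 else 0) +
        rounds_to_go var G (opponent p) (U - {v}) (insert v C)"
      by (rule rounds_to_go_move[OF psubset.hyps 3])
    have v0: "rounds_to_go var G (opponent p) (U - {v}) (insert v C) = 0"
      using step psubset.prems(2) by simp
    have "v \<in> U" using v by (simp add: playable_def)
    then have "U - {v} \<subset> U" by blast
    from psubset.IH[OF this independent_insert_playable[OF psubset.prems(1) v] v0]
    have "indep_verts G (insert v C \<union> (U - {v}))" .
    then show ?thesis by (rule indep_verts_subset) blast
  qed
qed

lemma rounds_to_go_le_1_imp_independent:
  assumes "finite U" "rounds_to_go var G p U {} \<le> 1"
  shows "indep_verts G U"
proof (cases "U = {}")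
  case True
  then show ?thesis by (simp add: indep_verts_def)
next
  case False
  obtain v where v: "v \<in> U" and step: "rounds_to_go var G p U {} =
      1 + rounds_to_go var G (opponent p) (U - {v}) {v}"
    by (rule rounds_to_go_new_round[OF assms(1) False])
  have v0: "rounds_to_go var G (opponent p) (U - {v}) {v} = 0"
    using step assms(2) by simp
  have "indep_verts G {v}" using adj_irrefl by (simp add: indep_verts_def)
  from rounds_to_go_eq_0_imp_independent[OF _ this v0] assms(1) v show ?thesis
    by (simp add: insert_absorb)
qed

text \<open>\<open>S\<close> is the final color class of the current round in one line of optimal
  play; the rest is colored in at most one more round and is therefore independent.\<close>

lemma rounds_to_go_le_1_imp_split:
  assumes "finite U" "indep_verts G C" "C \<noteq> {}" "rounds_to_go var G p U C \<le> 1"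
  shows "\<exists>S. C \<subseteq> S \<and> S \<subseteq> C \<union> U \<and> indep_verts G S \<and> indep_verts G (U - S)"
  using assms
proof (induction U arbitrary: C p rule: finite_psubset_induct)
  case (psubset U)
  consider "U = {}" | "U \<noteq> {}" "playable G U C = {}" | "playable G U C \<noteq> {}"
    by blast
  then show ?case
  proof cases
    case 1
    then show ?thesis
      using psubset.prems by (intro exI[of _ C]) (auto simp: indep_verts_def)
  next
    case 2
    have "rounds_to_go var G (next_starter var (opponent p)) U {} \<le> 1"
      using rounds_to_go_completed[OF psubset.hyps 2, of var p] psubset.prems(3) by simp
    then have "indep_verts G U"
      by (rule rounds_to_go_le_1_imp_independent[OF psubset.hyps])
    then show ?thesis
      using psubset.prems(1) by (intro exI[of _ C]) (auto intro: indep_verts_subset)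
  next
    case 3
    obtain v where v: "v \<in> playable G U C"
      and step: "rounds_to_go var G p U C = (if C = {} then 1 else 0) +
        rounds_to_go var G (opponent p) (U - {v}) (insert v C)"
      by (rule rounds_to_go_move[OF psubset.hyps 3])
    have v1: "rounds_to_go var G (opponent p) (U - {v}) (insert v C) \<le> 1"
      using step psubset.prems(3) by simp
    have "v \<in> U" using v by (simp add: playable_def)
    then have "U - {v} \<subset> U" by blast
    from psubset.IH[OF this independent_insert_playable[OF psubset.prems(1) v] insert_not_empty v1]
    obtain S where S: "insert v C \<subseteq> S" "S \<subseteq> insert v C \<union> (U - {v})"
      "indep_verts G S" "indep_verts G (U - {v} - S)" by blast
    have "U - S = U - {v} - S" using S(1) by blast
    then show ?thesis using S \<open>v \<in> U\<close> by (intro exI[of _ S]) auto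
  qed
qed

text \<open>Every arc changes sides in both bipartitions, so agreement at \<open>a\<close>
  propagates along a path to \<open>v\<close>.\<close>

lemma bipartition_unique:
  assumes "a \<rightarrow>\<^sup>*\<^bsub>G\<^esub> v" "a \<in> S" "a \<in> T"
    "indep_verts G S" "indep_verts G (verts G - S)" "indep_verts G T" "indep_verts G (verts G - T)"
    "wf_digraph G"
  shows "v \<in> S \<longleftrightarrow> v \<in> T"
proof -
  interpret wf_digraph G by fact
  show ?thesis
    using assms(1)
  proof (induction rule: reachable_induct)
    case base
    then show ?case using assms by simp
  next
    case (step x y)
    have "x \<in> verts G" "y \<in> verts G" using step(2) by auto
    then show ?case using step assms unfolding indep_verts_def by blast
  qed
qed

end

section \<open>Games of two rounds\<close>

text \<open>Deleting a vertex of \<open>Y\<close> can isolate vertices of \<open>X\<close>, so the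
  two-round condition is phrased in a form that also fits disconnected graphs.\<close>

definition dominated_bipartition :: "('a,'b) pre_digraph \<Rightarrow> 'a \<Rightarrow> 'a set \<Rightarrow> 'a set \<Rightarrow> bool" where
  "dominated_bipartition G a X Y \<longleftrightarrow> a \<in> X \<and> Y \<noteq> {} \<and> X \<inter> Y = {} \<and> verts G = X \<union> Y \<and>
    indep_verts G X \<and> indep_verts G Y \<and> (\<forall>y\<in>Y. a \<rightarrow>\<^bsub>G\<^esub> y)"

context game_graph
begin

text \<open>Opening with \<open>a\<close> blocks \<open>Y\<close> at once, which gives the upper
  bound; an arc from \<open>a\<close> into \<open>Y\<close> rules out a single round.\<close>

lemma rounds_to_go_eq_2:
  assumes "finite (verts G)" "dominated_bipartition G a X Y"
  shows "rounds_to_go var G Alice (verts G) {} = 2"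
proof -
  note d = assms(2)[unfolded dominated_bipartition_def]
  have "verts G - {a} = (X - {a}) \<union> Y" "insert a X = X" using d by auto
  then have "rounds_to_go var G Bob (verts G - {a}) {a} = 1"
    using d assms(1) rounds_to_go_dominated_side[of "X - {a}" Y G "{a}" var Bob] by auto
  then have "rounds_to_go var G Alice (verts G) {} \<le> 2"
    using rounds_to_go_Alice_first_le[OF assms(1), of a var G] d by simp
  moreover have "\<not> indep_verts G (verts G)"
    using d by (auto simp: indep_verts_def)
  ultimately show ?thesis
    using rounds_to_go_le_1_imp_independent[OF assms(1), of var Alice] by linarith
qed

text \<open>Two plays after an optimal opening \<open>a\<close> are compared: optimal replies yield
  the class \<open>X\<close>, and a reply \<open>y\<close> not adjacent to \<open>a\<close> would
  yield a class \<open>S\<close> containing both \<open>a\<close> and \<open>y\<close>.\<close>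

lemma rounds_to_go_eq_2_imp_dominated_bipartition:
  assumes "graph G" "connected G" "rounds_to_go var G Alice (verts G) {} = 2"
  obtains a X Y where "dominated_bipartition G a X Y"
proof -
  interpret graph G by fact
  have "verts G \<noteq> {}" using assms(3) by (subst (asm) rounds_to_go.simps) auto
  obtain a where a: "a \<in> verts G" and first_move: "rounds_to_go var G Alice (verts G) {} =
      1 + rounds_to_go var G (opponent Alice) (verts G - {a}) {a}"
    by (rule rounds_to_go_new_round[OF finite_verts \<open>verts G \<noteq> {}\<close>])
  have a1: "rounds_to_go var G Bob (verts G - {a}) {a} = 1"
    using first_move assms(3) by simp
  \<comment> \<open>\<open>connected\<close> speaks of the symmetric closure, which has the same
    reachability as \<open>G\<close> because the arcs are symmetric.\<close>
  have reach: "a \<rightarrow>\<^sup>*\<^bsub>G\<^esub> v" if "v \<in> verts G" for v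
    using assms(2) that a unfolding connected_def strongly_connected_def
    by (simp add: reachable_mk_symmetric_eq[OF sym_arcs])
  have split: "\<exists>S. C \<subseteq> S \<and> S \<subseteq> verts G \<and> indep_verts G S \<and> indep_verts G (verts G - S)"
    if "a \<in> C" "C \<subseteq> verts G" "indep_verts G C" "rounds_to_go var G p (verts G - C) C \<le> 1" for C p
  proof -
    have "finite (verts G - C)" "C \<noteq> {}" using that(1) by auto
    from rounds_to_go_le_1_imp_split[OF this(1) that(3) this(2) that(4)]
    obtain S where S: "C \<subseteq> S" "S \<subseteq> C \<union> (verts G - C)" "indep_verts G S"
        "indep_verts G (verts G - C - S)"
      by blast
    have "verts G - S = verts G - C - S" using S(1) by blast
    with S \<open>C \<subseteq> verts G\<close> show ?thesis by (intro exI[of _ S]) auto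
  qed
  have "indep_verts G {a}" using adj_irrefl by (simp add: indep_verts_def)
  then obtain X where X: "a \<in> X" "X \<subseteq> verts G" "indep_verts G X" "indep_verts G (verts G - X)"
    using split[of "{a}" Bob] a a1 by force
  have dom: "a \<rightarrow>\<^bsub>G\<^esub> y" if y: "y \<in> verts G - X" for y
  proof (rule ccontr)
    assume na: "\<not> a \<rightarrow>\<^bsub>G\<^esub> y"
    then have pl: "y \<in> playable G (verts G - {a}) {a}"
      using y X(1) by (auto simp: playable_def)
    have "verts G - {a} - {y} = verts G - {y, a}" by auto
    \<comment> \<open>The reply \<open>y\<close> need not be optimal for Bob, so it leaves at most
      the value 1 that he could reach.\<close>
    then have "rounds_to_go var G Alice (verts G - {y, a}) {y, a} \<le> 1"
      using rounds_to_go_Bob_ge[OF _ pl, of var] a1 by simp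
    then obtain S where S: "{y, a} \<subseteq> S" "indep_verts G S" "indep_verts G (verts G - S)"
      using split[of "{y, a}" Alice] y a independent_insert_playable[OF \<open>indep_verts G {a}\<close> pl]
      by auto
    \<comment> \<open>\<open>S\<close> and \<open>X\<close> both contain \<open>a\<close>, so
      uniqueness puts \<open>y\<close> into \<open>X\<close>, although \<open>y\<close> was taken
      outside.\<close>
    then show False
      using bipartition_unique[OF reach[of y], of S X] X y wf_digraph_axioms by auto
  qed
  have "verts G - X \<noteq> {}"
  proof
    assume "verts G - X = {}"
    then have "indep_verts G (verts G)" using X(2,3) by (metis Diff_eq_empty_iff subset_antisym)
    then show False
      using rounds_to_go_independent[of "verts G" G "{}" var Alice] \<open>verts G \<noteq> {}\<close> assms(3) by simp
  qed
  then show ?thesis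
    using that[of a X "verts G - X"] X dom by (auto simp: dominated_bipartition_def)
qed

end

section \<open>Vertex deletion and criticality\<close>

lemma adj_del_vert: "u \<rightarrow>\<^bsub>pre_digraph.del_vert G x\<^esub> v \<longleftrightarrow> u \<rightarrow>\<^bsub>G\<^esub> v \<and> u \<noteq> x \<and> v \<noteq> x"
  by (auto simp: arcs_ends_def arc_to_ends_def pre_digraph.del_vert_def image_iff)

text \<open>Makes \<open>rounds_to_go_eq_2\<close> available for vertex-deleted graphs.\<close>

lemma (in game_graph) game_graph_del_vert: "game_graph (pre_digraph.del_vert G x)"
  using adj_sym adj_irrefl by unfold_locales (auto simp: adj_del_vert)

lemma dominated_bipartition_del_vert:
  assumes "dominated_bipartition G a X Y" "x \<noteq> a" "Y - {x} \<noteq> {}"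
  shows "dominated_bipartition (pre_digraph.del_vert G x) a (X - {x}) (Y - {x})"
  using assms
  by (auto simp: dominated_bipartition_def pre_digraph.verts_del_vert indep_verts_def adj_del_vert)

lemma graph_imp_game_graph: "graph G \<Longrightarrow> game_graph G"
proof -
  assume "graph G"
  then interpret graph G .
  show ?thesis
    using sym_arcs no_loops by unfold_locales (auto simp: symmetric_def arcs_ends_conv dest: symD)
qed

text \<open>Alice opens the first round in both games, and the facts about later rounds hold for any
  starter, so one argument with arbitrary \<open>var\<close> settles both.\<close>

lemma two_critical_iff_complete:
  assumes "graph G" "connected G"
  shows "game_vertex_critical 2 (\<lambda>H. rounds_to_go var H Alice (verts H) {}) G \<longleftrightarrow>
    complete_digraph 2 G"
proof -
  interpret graph G by fact
  interpret game_graph G using assms(1) by (rule graph_imp_game_graph)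
  show ?thesis
  proof
    assume crit: "game_vertex_critical 2 (\<lambda>H. rounds_to_go var H Alice (verts H) {}) G"
    then have "rounds_to_go var G Alice (verts G) {} = 2"
      unfolding game_vertex_critical_def by simp
    then obtain a X Y where d: "dominated_bipartition G a X Y"
      by (rule rounds_to_go_eq_2_imp_dominated_bipartition[OF assms])
    note d' = d[unfolded dominated_bipartition_def]
    \<comment> \<open>If some of \<open>Y\<close> survived the deletion of \<open>x\<close>, then
      \<open>a\<close> would still dominate it and the value would remain 2, against
      criticality.\<close>
    have empty: "Y - {x} = {}" if "x \<in> verts G" "x \<noteq> a" for x
    proof (rule ccontr)
      assume "Y - {x} \<noteq> {}"
      from dominated_bipartition_del_vert[OF d that(2) this]
      have "rounds_to_go var (del_vert x) Alice (verts (del_vert x)) {} = 2"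
        by (rule game_graph.rounds_to_go_eq_2[OF game_graph_del_vert, rotated])
          (simp add: verts_del_vert)
      then show False using crit that(1) unfolding game_vertex_critical_def by metis
    qed
    obtain y where y: "y \<in> Y" using d' by blast
    have ay: "a \<in> verts G" "y \<in> verts G" "a \<noteq> y" "a \<rightarrow>\<^bsub>G\<^esub> y" using y d' by auto
    have "x = y" if "x \<in> verts G" "x \<noteq> a" for x
      using empty[OF that] y by blast
    with ay have V: "verts G = {a, y}" by blast
    moreover have "arcs_ends G = {(u,v). (u,v) \<in> verts G \<times> verts G \<and> u \<noteq> v}"
    proof (intro set_eqI iffI)
      fix e assume e: "e \<in> arcs_ends G"
      then show "e \<in> {(u,v). (u,v) \<in> verts G \<times> verts G \<and> u \<noteq> v}"
        using adj_irrefl adj_in_verts by (cases e) auto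
    next
      fix e assume "e \<in> {(u,v). (u,v) \<in> verts G \<times> verts G \<and> u \<noteq> v}"
      then show "e \<in> arcs_ends G"
        using ay(4) adj_sym[OF ay(4)] V by auto
    qed
    ultimately show "complete_digraph 2 G"
      using assms(1) ay(3) unfolding complete_digraph_def by simp
  next
    assume "complete_digraph 2 G"
    then have "card (verts G) = 2" and
      arcs: "arcs_ends G = {(u,v). (u,v) \<in> verts G \<times> verts G \<and> u \<noteq> v}"
      unfolding complete_digraph_def by auto
    then obtain u v where uv: "verts G = {u, v}" "u \<noteq> v" by (meson card_2_iff)
    then have "dominated_bipartition G u {u} {v}"
      using arcs by (auto simp: dominated_bipartition_def indep_verts_def)
    then have "rounds_to_go var G Alice (verts G) {} = 2"
      by (rule rounds_to_go_eq_2[OF finite_verts])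
    \<comment> \<open>A single vertex is left, and it takes one round.\<close>
    moreover have "rounds_to_go var (del_vert x) Alice (verts (del_vert x)) {} = 1"
      if "x \<in> verts G" for x
      using uv that arcs
      by (subst rounds_to_go_independent) (auto simp: verts_del_vert indep_verts_def adj_del_vert)
    ultimately show "game_vertex_critical 2 (\<lambda>H. rounds_to_go var H Alice (verts H) {}) G"
      unfolding game_vertex_critical_def by simp
  qed
qed

theorem proposition22:
  fixes G :: "('a,'b) pre_digraph"
  assumes "graph G" and "connected G"
  shows "(game_vertex_critical 2 chi_ig_A G \<longleftrightarrow> complete_digraph 2 G) \<and>
         (game_vertex_critical 2 chi_ig_AB G \<longleftrightarrow> complete_digraph 2 G)"
  using two_critical_iff_complete[OF assms]
  unfolding chi_ig_A_def[abs_def] chi_ig_AB_def[abs_def] by blast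

end
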